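(* Let $d\ge 2$, let $\mathbf a=(a_1,\dots,a_d)\in\mathbb R^d$ with $a_i>0$ for all $i$ (length vector), and let $\mathbf b=(b_1,\dots,b_d)\in\mathbb R^d$ (height vector). Put $\zeta_i=(a_i,b_i)\in\mathbb R^2$ and $\kappa_i=b_i/a_i$, and suppose that the slopes are strictly decreasing: $\kappa_1>\kappa_2>\dots>\kappa_d$. Let $\sigma$ be any irreducible permutation of $\{1,\dots,d\}$. Let $\Gamma_t$ be the polygonal curve in $\mathbb R^2$ connecting successively the points $C^t_j=\sum_{i\le j}\zeta_i$, $j=0,1,\dots,d$, and let $\Gamma_b$ be the polygonal curve connecting successively the points $C^b_j=\sum_{i\le j}\zeta_{\sigma^{-1}(i)}$, $j=0,1,\dots,d$. Then the closed curve $\Gamma=\Gamma_t\cup\Gamma_b$ has no self-intersections, i.e. $\Gamma_t$ and $\Gamma_b$ meet only at their common endpoints $C_0^t=C_0^b=(0,0)$ and $C_d^t=C_d^b=\sum_{i=1}^d\zeta_i$. In particular, if the interval exchange transformation $T$ associated to $(\sigma,\mathbf a)$ has no connections, then $(\mathbf a,\mathbf b)$ is a positive pair (with respect to $\sigma$).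
   Context: A permutation $\sigma$ of $\{1,\dots,d\}$ is irreducible if whenever $\{1,\dots,k\}$ with $1\le k\le d$ is invariant under $\sigma$, then $k=d$. Interval exchange transformation: for $\mathbf a\in\mathbb R^d$ with all $a_i>0$, let $x_i=\sum_{j\le i}a_j$ and $x'_i=\sum_{j\le i}a_{\sigma^{-1}(j)}$ for $0\le i\le d$, let $I_{\mathbf a}=[0,\sum_i a_i)$ and $I_i=[x_{i-1},x_i)$ for $1\le i\le d$. The interval exchange transformation $T:I_{\mathbf a}\to I_{\mathbf a}$ associated to $(\sigma,\mathbf a)$ is $T(x)=x-x_j+x'_{\sigma(j)}$ for $x\in I_j$; that is, $T$ permutes the intervals $I_j$ by translations according to $\sigma$. A connection of $T$ is a triple $(m,x_i,x_j)$ with $m\ge 1$ an integer and $x_i,x_j$ discontinuities ($1\le i,j\le d-1$) such that $T^m(x_i)=x_j$. Positive pair: for $\mathbf b\in\mathbb R^d$ put $y_i=\sum_{j\le i}b_j$ and $y'_i=\sum_{j\le i}b_{\sigma^{-1}(j)}$, and define the function $L:I_{\mathbf a}\to\mathbb R$ by $L(x)=y_i-y'_{\sigma(i)}$ for $x\in I_i$. The pair $(\mathbf a,\mathbf b)$ is a positive pair if $\mu(L)=\int L\,d\mu>0$ for every $T$-invariant Borel probability measure $\mu$ on $I_{\mathbf a}$. *)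

theory Defs
  imports "HOL-Analysis.Analysis" "HOL-Probability.Probability"
begin

text \<open>
  Vectors in $d$-dimensional real space are functions \<^typ>\<open>nat \<Rightarrow> real\<close> of which only the values at
  the indices $1, \dots, d$ are used; a permutation of $\{1, \dots, d\}$ is a function
  \<open>\<sigma>\<close> with \<open>\<sigma> permutes {1..d}\<close>, so that \<open>inv \<sigma>\<close> is its inverse permutation.
\<close>

definition irreducible_perm :: "nat \<Rightarrow> (nat \<Rightarrow> nat) \<Rightarrow> bool" where
  "irreducible_perm d \<sigma> \<longleftrightarrow> \<sigma> permutes {1..d} \<and>
     (\<forall>k\<in>{1..d}. \<sigma> ` {1..k} \<subseteq> {1..k} \<longrightarrow> k = d)"

text \<open>
  The $i$-th partial sum of a vector. With \<open>u = a\<close> this is $x_i$, with \<open>u = b\<close> it is $y_i$, and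
  precomposition with \<open>inv \<sigma>\<close> gives $x'_i$ and $y'_i$; for vectors of points of the plane it gives
  the vertices of the polygonal curves.
\<close>

definition psum :: "(nat \<Rightarrow> 'a::comm_monoid_add) \<Rightarrow> nat \<Rightarrow> 'a" where
  "psum u i = (\<Sum>j=1..i. u j)"

definition iet_domain :: "nat \<Rightarrow> (nat \<Rightarrow> real) \<Rightarrow> real set" where
  "iet_domain d a = {0..<psum a d}"

definition iet_interval :: "(nat \<Rightarrow> real) \<Rightarrow> nat \<Rightarrow> real set" where
  "iet_interval a i = {psum a (i - 1)..<psum a i}"

text \<open>
  For positive lengths the intervals partition the domain, so the index below is well defined
  there; outside the domain it is unspecified.
\<close>

definition iet_index :: "nat \<Rightarrow> (nat \<Rightarrow> real) \<Rightarrow> real \<Rightarrow> nat" where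
  "iet_index d a x = (THE j. j \<in> {1..d} \<and> x \<in> iet_interval a j)"

definition iet :: "nat \<Rightarrow> (nat \<Rightarrow> nat) \<Rightarrow> (nat \<Rightarrow> real) \<Rightarrow> real \<Rightarrow> real" where
  "iet d \<sigma> a x = (let j = iet_index d a x in x - psum a j + psum (a \<circ> inv \<sigma>) (\<sigma> j))"

text \<open>
  As is customary, all of the points $x_1, \dots, x_{d-1}$ count as discontinuities, including
  those at which the two adjacent intervals happen to be moved by the same translation.
\<close>

definition is_connection ::
    "nat \<Rightarrow> (nat \<Rightarrow> nat) \<Rightarrow> (nat \<Rightarrow> real) \<Rightarrow> nat \<times> real \<times> real \<Rightarrow> bool" where
  "is_connection d \<sigma> a = (\<lambda>(m, p, q).
     m \<ge> 1 \<and> p \<in> psum a ` {1..d - 1} \<and> q \<in> psum a ` {1..d - 1} \<and> (iet d \<sigma> a ^^ m) p = q)"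

definition iet_invariant_prob ::
    "nat \<Rightarrow> (nat \<Rightarrow> nat) \<Rightarrow> (nat \<Rightarrow> real) \<Rightarrow> real measure \<Rightarrow> bool" where
  "iet_invariant_prob d \<sigma> a \<mu> \<longleftrightarrow>
     space \<mu> = iet_domain d a \<and>
     sets \<mu> = sets (restrict_space borel (iet_domain d a)) \<and>
     prob_space \<mu> \<and>
     (\<forall>A\<in>sets \<mu>. emeasure \<mu> (iet d \<sigma> a -` A \<inter> space \<mu>) = emeasure \<mu> A)"

definition height_fun ::
    "nat \<Rightarrow> (nat \<Rightarrow> nat) \<Rightarrow> (nat \<Rightarrow> real) \<Rightarrow> (nat \<Rightarrow> real) \<Rightarrow> real \<Rightarrow> real" where
  "height_fun d \<sigma> a b x =
     (let i = iet_index d a x in psum b i - psum (b \<circ> inv \<sigma>) (\<sigma> i))"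

definition positive_pair ::
    "nat \<Rightarrow> (nat \<Rightarrow> nat) \<Rightarrow> (nat \<Rightarrow> real) \<Rightarrow> (nat \<Rightarrow> real) \<Rightarrow> bool" where
  "positive_pair d \<sigma> a b \<longleftrightarrow>
     (\<forall>\<mu>. iet_invariant_prob d \<sigma> a \<mu> \<longrightarrow> (\<integral>x. height_fun d \<sigma> a b x \<partial>\<mu>) > 0)"

fun polygonal_path :: "'a::real_normed_vector list \<Rightarrow> real \<Rightarrow> 'a" where
  "polygonal_path [] = linepath 0 0"
| "polygonal_path [p] = linepath p p"
| "polygonal_path [p, q] = linepath p q"
| "polygonal_path (p # q # r # ps) = linepath p q +++ polygonal_path (q # r # ps)"

definition top_curve :: "nat \<Rightarrow> (nat \<Rightarrow> real \<times> real) \<Rightarrow> real \<Rightarrow> real \<times> real" where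
  "top_curve d \<zeta> = polygonal_path (map (psum \<zeta>) [0..<d + 1])"

definition bottom_curve ::
    "nat \<Rightarrow> (nat \<Rightarrow> nat) \<Rightarrow> (nat \<Rightarrow> real \<times> real) \<Rightarrow> real \<Rightarrow> real \<times> real" where
  "bottom_curve d \<sigma> \<zeta> = polygonal_path (map (psum (\<zeta> \<circ> inv \<sigma>)) [0..<d + 1])"

end

theory Submission
  imports Defs
begin

text \<open>
  Since the slopes decrease, the top curve is the graph of a concave function \<open>F\<close>, the minimum of
  the affine functions extending its edges, whereas the bottom curve is the graph of some
  function \<open>G\<close>. A vertex of the bottom curve lies below the line through the \<open>i\<close>-th top edge:
  among all sums of vectors \<open>\<zeta>\<^sub>j\<close> over subsets of the indices, \<open>\<zeta>\<^sub>1 + \<dots> + \<zeta>\<^sub>i\<close> is highest above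
  a line of slope \<open>\<kappa>\<^sub>i\<close>. Irreducibility makes this strict at inner vertices, and every bottom edge
  has an inner vertex because \<open>d \<ge> 2\<close>; so \<open>G < F\<close> away from the two ends.

  On the \<open>j\<close>-th interval the height function is \<open>F - G \<circ> T\<close>, so for an invariant measure its
  integral is that of \<open>F - G\<close>. It is positive unless the measure is concentrated at \<open>0\<close>, which is
  impossible because irreducibility forces \<open>T 0 \<noteq> 0\<close>.
\<close>

section \<open>Polygonal paths\<close>

lemma pathstart_polygonal_path: "pathstart (polygonal_path (p # ps)) = p"
  by (cases "p # ps" rule: polygonal_path.cases) auto

lemma pathfinish_polygonal_path: "ps \<noteq> [] \<Longrightarrow> pathfinish (polygonal_path ps) = last ps"
  by (induction ps rule: polygonal_path.induct) auto

lemma path_image_polygonal_path: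
  "length ps \<ge> 2 \<Longrightarrow>
     path_image (polygonal_path ps) = (\<Union>i<length ps - 1. closed_segment (ps ! i) (ps ! Suc i))"
proof (induction ps rule: polygonal_path.induct)
  case (4 p q r ps)
  have "path_image (polygonal_path (p # q # r # ps)) =
      closed_segment p q \<union> path_image (polygonal_path (q # r # ps))"
    by (simp add: path_image_join pathstart_polygonal_path)
  with 4 show ?case
    by (simp add: lessThan_Suc_eq_insert_0 image_image)
qed auto

text \<open>Along the segment \<open>f\<close> is an affine function of the parameter; as it
  increases strictly, \<open>q\<close> is the only point where the maximum is attained.\<close>

lemma linear_closed_segment_bounds:
  fixes f :: "'a::real_normed_vector \<Rightarrow> real"
  assumes "linear f" "f p < f q" "z \<in> closed_segment p q"
  shows "f p \<le> f z" "f z \<le> f q" "f z = f q \<Longrightarrow> z = q"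
proof -
  obtain u where u: "0 \<le> u" "u \<le> 1" "z = (1 - u) *\<^sub>R p + u *\<^sub>R q"
    using assms(3) by (auto simp: in_segment)
  have fz: "f z = f p + u * (f q - f p)"
    unfolding u(3) linear_add[OF assms(1)] linear_scale[OF assms(1)] by (simp add: algebra_simps)
  show "f p \<le> f z"
    using fz u assms(2) by simp
  have "f q - f z = (1 - u) * (f q - f p)"
    by (simp add: fz algebra_simps)
  then show "f z \<le> f q" "f z = f q \<Longrightarrow> z = q"
    using u assms(2) by (smt (verit) mult_nonneg_nonneg, auto)
qed

lemma polygonal_path_ge_start:
  fixes f :: "'a::real_normed_vector \<Rightarrow> real"
  assumes "linear f" "sorted_wrt (\<lambda>p q. f p < f q) ps" "length ps \<ge> 2"
    and "z \<in> path_image (polygonal_path ps)"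
  shows "f (hd ps) \<le> f z"
proof -
  obtain i where i: "i < length ps - 1" "z \<in> closed_segment (ps ! i) (ps ! Suc i)"
    using assms by (auto simp: path_image_polygonal_path)
  have "f (ps ! i) < f (ps ! Suc i)"
    using assms(2) i(1) by (simp add: sorted_wrt_iff_nth_less)
  then have "f (ps ! i) \<le> f z"
    using linear_closed_segment_bounds(1)[OF assms(1) _ i(2)] by simp
  moreover have "f (hd ps) \<le> f (ps ! i)"
  proof (cases "i = 0")
    case False
    then have "f (ps ! 0) < f (ps ! i)"
      using assms(2) i(1) by (simp add: sorted_wrt_iff_nth_less)
    moreover have "ps \<noteq> []" using assms(3) by auto
    ultimately show ?thesis by (simp add: hd_conv_nth)
  next
    case True
    moreover have "ps \<noteq> []" using assms(3) by auto
    ultimately show ?thesis by (simp add: hd_conv_nth)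
  qed
  ultimately show ?thesis by simp
qed

text \<open>A linear functional that grows from vertex to vertex prevents the path from returning:
  \<open>f\<close> is at most \<open>f q\<close> on the first edge and at least \<open>f q\<close>
  on the rest, so the two share only \<open>q\<close>. It is applied with
  \<open>f = fst\<close>.\<close>

lemma arc_polygonal_path:
  fixes f :: "'a::real_normed_vector \<Rightarrow> real"
  assumes "linear f"
  shows "sorted_wrt (\<lambda>p q. f p < f q) ps \<Longrightarrow> length ps \<ge> 2 \<Longrightarrow> arc (polygonal_path ps)"
proof (induction ps rule: polygonal_path.induct)
  case (4 p q r ps)
  have "path_image (linepath p q) \<inter> path_image (polygonal_path (q # r # ps)) \<subseteq> {q}"
  proof
    fix z assume "z \<in> path_image (linepath p q) \<inter> path_image (polygonal_path (q # r # ps))"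
    then have z: "z \<in> closed_segment p q" "z \<in> path_image (polygonal_path (q # r # ps))"
      by auto
    have "f p < f q"
      using 4 by simp
    moreover have "f q \<le> f z"
      using polygonal_path_ge_start[OF assms _ _ z(2)] 4 by simp
    ultimately show "z \<in> {q}"
      using linear_closed_segment_bounds[OF assms _ z(1)] by fastforce
  qed
  moreover have "arc (polygonal_path (q # r # ps))" "arc (linepath p q)"
    using 4 by (auto intro!: arc_linepath)
  ultimately show ?case
    by (auto intro!: arc_join simp: pathstart_polygonal_path)
qed (auto intro: arc_linepath)

section \<open>Partial sums and interval indices\<close>

lemma psum_0 [simp]: "psum u 0 = 0"
  by (simp add: psum_def)

lemma psum_Suc [simp]: "psum u (Suc i) = psum u i + u (Suc i)"
  by (simp add: psum_def)

lemma psum_pred: "i \<ge> 1 \<Longrightarrow> psum u i = psum u (i - 1) + u i"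
  by (cases i) auto

lemma psum_pair:
  fixes \<zeta> :: "nat \<Rightarrow> 'a::comm_monoid_add \<times> 'b::comm_monoid_add"
  assumes "\<forall>i\<in>{1..d}. \<zeta> i = (a i, b i)" "k \<le> d"
  shows "psum \<zeta> k = (psum a k, psum b k)"
  using assms(2)
proof (induction k)
  case (Suc k)
  then have "\<zeta> (Suc k) = (a (Suc k), b (Suc k))" using assms(1) by simp
  with Suc show ?case by simp
qed (simp add: zero_prod_def)

lemma psum_less:
  fixes a :: "nat \<Rightarrow> real"
  assumes "\<forall>i\<in>{1..d}. a i > 0" "i < j" "j \<le> d"
  shows "psum a i < psum a j"
proof -
  have "psum a j = psum a i + sum a {i<..j}"
    unfolding psum_def using assms(2)
    by (subst sum.union_disjoint[symmetric]) (auto intro!: sum.cong)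
  moreover have "sum a {i<..j} > 0"
    using assms by (intro sum_pos) auto
  ultimately show ?thesis by simp
qed

lemma psum_le:
  fixes a :: "nat \<Rightarrow> real"
  assumes "\<forall>i\<in>{1..d}. a i > 0" "i \<le> j" "j \<le> d"
  shows "psum a i \<le> psum a j"
  using psum_less[of d a i j] assms by (cases "i = j") auto

text \<open>Turns a coordinate of a bottom vertex into a sum over a set of indices, the form in
  which \<open>edge_gap_vertex\<close> compares it with a top vertex.\<close>

lemma psum_permuted:
  assumes "\<sigma> permutes {1..d}"
  shows "psum (u \<circ> inv \<sigma>) k = sum u (inv \<sigma> ` {1..k})"
  unfolding psum_def using permutes_inj[OF permutes_inv[OF assms]]
  by (subst sum.reindex) (auto intro: inj_on_subset)

lemma psum_permuted_all: "\<sigma> permutes {1..d} \<Longrightarrow> psum (u \<circ> inv \<sigma>) d = psum u d"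
  using permutes_image[OF permutes_inv, of \<sigma> "{1..d}"]
  by (simp only: psum_permuted) (simp add: psum_def)

lemma iet_index_eq:
  assumes "\<forall>i\<in>{1..d}. a i > 0" "j \<in> {1..d}" "x \<in> iet_interval a j"
  shows "iet_index d a x = j"
  unfolding iet_index_def
proof (rule the_equality)
  fix k assume k: "k \<in> {1..d} \<and> x \<in> iet_interval a k"
  show "k = j"
  proof (rule ccontr)
    assume "k \<noteq> j"
    then consider "k \<le> j - 1" | "j \<le> k - 1" using assms(2) k by fastforce
    then show False
    proof cases
      case 1
      then have "psum a k \<le> psum a (j - 1)"
        using assms(2) by (intro psum_le[OF assms(1)]) auto
      then show ?thesis using k assms(3) by (simp add: iet_interval_def)
    next
      case 2
      then have "psum a j \<le> psum a (k - 1)"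
        using k by (intro psum_le[OF assms(1)]) auto
      then show ?thesis using k assms(3) by (simp add: iet_interval_def)
    qed
  qed
qed (use assms in auto)

lemma iet_index_in:
  assumes "\<forall>i\<in>{1..d}. a i > 0" "x \<in> iet_domain d a"
  shows "iet_index d a x \<in> {1..d}" "x \<in> iet_interval a (iet_index d a x)"
proof -
  \<comment> \<open>The first right endpoint beyond \<open>x\<close>; minimality puts the preceding
    endpoint at or before \<open>x\<close>.\<close>
  define j where "j = (LEAST j. x < psum a j)"
  have x: "x < psum a d" "0 \<le> x"
    using assms(2) by (auto simp: iet_domain_def)
  have j: "x < psum a j" "j \<le> d"
    unfolding j_def using x by (auto intro: LeastI Least_le)
  moreover have "j \<ge> 1"
    using j x by (cases j) auto
  moreover have "psum a (j - 1) \<le> x"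
    using not_less_Least[of "j - 1" "\<lambda>j. x < psum a j"] \<open>j \<ge> 1\<close> by (auto simp: j_def[symmetric])
  ultimately have "j \<in> {1..d}" "x \<in> iet_interval a j"
    by (auto simp: iet_interval_def)
  then show "iet_index d a x \<in> {1..d}" "x \<in> iet_interval a (iet_index d a x)"
    using iet_index_eq[OF assms(1)] by auto
qed

lemma measurable_iet_index:
  assumes "\<forall>i\<in>{1..d}. a i > 0"
  shows "iet_index d a \<in> restrict_space borel (iet_domain d a) \<rightarrow>\<^sub>M count_space UNIV"
proof -
  let ?M = "restrict_space borel (iet_domain d a)"
  have "iet_index d a -` {j} \<inter> space ?M = iet_interval a j \<inter> iet_domain d a" if "j \<in> {1..d}" for j
    using that iet_index_in[OF assms] iet_index_eq[OF assms] by (auto simp: space_restrict_space)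
  then have "iet_index d a \<in> ?M \<rightarrow>\<^sub>M count_space {1..d}"
    using iet_index_in[OF assms]
    by (subst measurable_count_space_eq2_countable)
       (auto simp: space_restrict_space sets_restrict_space iet_interval_def)
  then show ?thesis
    by (rule measurable_compose) simp
qed

section \<open>The curves as graphs\<close>

text \<open>Stated for arbitrary positive lengths so that it serves the top curve and, for the
  permuted vectors, the bottom curve. Positive lengths make the first coordinates of the vertices
  increase, whence the arc.\<close>

lemma polygonal_curve:
  fixes d :: nat and \<zeta> :: "nat \<Rightarrow> real \<times> real"
  defines "\<gamma> \<equiv> polygonal_path (map (psum \<zeta>) [0..<d + 1])"
  assumes "d \<ge> 1" and pos: "\<forall>i\<in>{1..d}. a i > 0" and \<zeta>: "\<forall>i\<in>{1..d}. \<zeta> i = (a i, b i)"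
  shows "arc \<gamma>" "pathstart \<gamma> = (0, 0)" "pathfinish \<gamma> = (psum a d, psum b d)"
    and "path_image \<gamma> =
      (\<Union>i\<in>{1..d}. closed_segment (psum a (i - 1), psum b (i - 1)) (psum a i, psum b i))"
proof -
  let ?ps = "map (psum \<zeta>) [0..<d + 1]"
  have nth: "?ps ! i = (psum a i, psum b i)" if "i \<le> d" for i
    using that psum_pair[OF \<zeta>] by (simp del: upt_Suc)
  have "sorted_wrt (\<lambda>p q. fst p < fst q) ?ps"
    unfolding sorted_wrt_iff_nth_less using nth psum_less[OF pos] by (simp del: upt_Suc)
  then show "arc \<gamma>"
    unfolding \<gamma>_def using \<open>d \<ge> 1\<close> by (intro arc_polygonal_path[OF linear_fst]) auto
  have "?ps = psum \<zeta> 0 # map (psum \<zeta>) [1..<d + 1]"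
    by (simp add: upt_conv_Cons del: upt_Suc)
  then show "pathstart \<gamma> = (0, 0)"
    unfolding \<gamma>_def by (metis pathstart_polygonal_path psum_0 zero_prod_def)
  show "pathfinish \<gamma> = (psum a d, psum b d)"
    unfolding \<gamma>_def using psum_pair[OF \<zeta>] by (subst pathfinish_polygonal_path) auto
  have "path_image \<gamma> = (\<Union>i<d. closed_segment (?ps ! i) (?ps ! Suc i))"
    unfolding \<gamma>_def using \<open>d \<ge> 1\<close> by (subst path_image_polygonal_path) (auto simp del: upt_Suc)
  also have "\<dots> = (\<Union>i<d. closed_segment (psum a i, psum b i) (psum a (Suc i), psum b (Suc i)))"
    by (intro SUP_cong refl arg_cong2[where f = closed_segment] nth) auto
  \<comment> \<open>The shift numbers an edge by its right endpoint, in agreement with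
    \<open>iet_interval\<close>.\<close>
  also have "\<dots> = (\<Union>i\<in>Suc ` {..<d}.
      closed_segment (psum a (i - 1), psum b (i - 1)) (psum a i, psum b i))"
    by (simp add: image_image)
  also have "Suc ` {..<d} = {1..d}"
    by (simp add: image_Suc_lessThan)
  finally show "path_image \<gamma> =
      (\<Union>i\<in>{1..d}. closed_segment (psum a (i - 1), psum b (i - 1)) (psum a i, psum b i))" .
qed

text \<open>The function on \<open>iet_domain d a\<close> whose graph is the polygon with edges \<open>(a j, b j)\<close>.\<close>

definition pl_interp :: "nat \<Rightarrow> (nat \<Rightarrow> real) \<Rightarrow> (nat \<Rightarrow> real) \<Rightarrow> real \<Rightarrow> real" where
  "pl_interp d a b x =
     (let j = iet_index d a x in psum b j + b j / a j * (x - psum a j))"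

lemma measurable_pl_interp:
  assumes "\<forall>i\<in>{1..d}. a i > 0"
  shows "pl_interp d a b \<in> borel_measurable (restrict_space borel (iet_domain d a))"
proof -
  let ?R = "restrict_space borel (iet_domain d a)"
  have index_meas: "(\<lambda>x. h (iet_index d a x)) \<in> borel_measurable ?R" for h :: "nat \<Rightarrow> real"
    by (rule measurable_compose[OF measurable_iet_index[OF assms]]) simp
  have ident: "(\<lambda>x. x) \<in> borel_measurable ?R"
    by (intro measurable_restrict_space1) simp
  show ?thesis
    unfolding pl_interp_def Let_def
    by (intro borel_measurable_add borel_measurable_times borel_measurable_diff
        index_meas[of "\<lambda>j. b j / a j"] index_meas ident)
qed

text \<open>Gives integrability over probability measures. The vertex height and the linear term are
  each bounded by the sum, the latter because \<open>x\<close> is at most \<open>a j\<close> away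
  from the right endpoint.\<close>

lemma pl_interp_bounded:
  assumes "\<forall>i\<in>{1..d}. a i > 0" "x \<in> iet_domain d a"
  shows "\<bar>pl_interp d a b x\<bar> \<le> 2 * (\<Sum>i=1..d. \<bar>b i\<bar>)"
proof -
  define j where "j = iet_index d a x"
  have j: "j \<in> {1..d}" "psum a (j - 1) \<le> x" "x < psum a j"
    using iet_index_in[OF assms] by (auto simp: j_def iet_interval_def)
  have "a j > 0" using assms j by blast
  have "\<bar>psum b j\<bar> \<le> (\<Sum>i=1..j. \<bar>b i\<bar>)"
    unfolding psum_def by (rule sum_abs)
  also have "\<dots> \<le> (\<Sum>i=1..d. \<bar>b i\<bar>)"
    using j by (intro sum_mono2) auto
  finally have *: "\<bar>psum b j\<bar> \<le> (\<Sum>i=1..d. \<bar>b i\<bar>)" .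
  have "\<bar>x - psum a j\<bar> \<le> a j"
    using j psum_pred[of j a] by auto
  then have "\<bar>b j\<bar> / a j * \<bar>x - psum a j\<bar> \<le> \<bar>b j\<bar> / a j * a j"
    using \<open>a j > 0\<close> by (intro mult_left_mono) auto
  also have "\<dots> = \<bar>b j\<bar>"
    using \<open>a j > 0\<close> by simp
  also have "\<dots> \<le> (\<Sum>i=1..d. \<bar>b i\<bar>)"
    using j by (intro member_le_sum) auto
  finally have "\<bar>b j / a j * (x - psum a j)\<bar> \<le> (\<Sum>i=1..d. \<bar>b i\<bar>)"
    using \<open>a j > 0\<close> by (simp add: abs_mult)
  with * show ?thesis
    unfolding pl_interp_def Let_def j_def[symmetric] by linarith
qed

lemma pl_interp_on_segment:
  assumes "\<forall>i\<in>{1..d}. a i > 0" "x \<in> iet_domain d a"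
  obtains k where "k \<in> {1..d}"
    "(x, pl_interp d a b x) \<in>
       closed_segment (psum a (k - 1), psum b (k - 1)) (psum a k, psum b k)"
proof
  define k where "k = iet_index d a x"
  show k: "k \<in> {1..d}"
    using iet_index_in[OF assms] by (simp add: k_def)
  have x: "psum a (k - 1) \<le> x" "x < psum a k"
    using iet_index_in[OF assms] by (auto simp: k_def iet_interval_def)
  have "a k > 0" using assms k by blast
  define u where "u = (x - psum a (k - 1)) / a k"
  have pred: "psum a k = psum a (k - 1) + a k" "psum b k = psum b (k - 1) + b k"
    using k psum_pred[of k a] psum_pred[of k b] by auto
  have "0 \<le> u" "u \<le> 1"
    using x pred \<open>a k > 0\<close> by (auto simp: u_def)
  moreover have "(x, pl_interp d a b x) =
      (1 - u) *\<^sub>R (psum a (k - 1), psum b (k - 1)) + u *\<^sub>R (psum a k, psum b k)"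
    using \<open>a k > 0\<close>
    by (simp add: pl_interp_def Let_def k_def[symmetric] pred u_def field_simps)
  ultimately show "(x, pl_interp d a b x) \<in>
      closed_segment (psum a (k - 1), psum b (k - 1)) (psum a k, psum b k)"
    by (auto simp: in_segment)
qed

section \<open>Position of points relative to the lines through the edges\<close>

text \<open>The height of the line through the \<open>i\<close>-th edge above the point \<open>p\<close>.\<close>

definition edge_gap :: "(nat \<Rightarrow> real) \<Rightarrow> (nat \<Rightarrow> real) \<Rightarrow> nat \<Rightarrow> real \<times> real \<Rightarrow> real" where
  "edge_gap a b i p = psum b i + b i / a i * (fst p - psum a i) - snd p"

text \<open>Reduces the sign of the gap along a segment to its values at the two endpoints.\<close>

lemma edge_gap_affine:
  "edge_gap a b i ((1 - u) *\<^sub>R p + u *\<^sub>R q) = (1 - u) * edge_gap a b i p + u * edge_gap a b i q"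
proof -
  \<comment> \<open>The slope becomes an opaque real \<open>c\<close>, which leaves a polynomial
    identity without division.\<close>
  have "y + c * ((1 - u) * s + u * t - x) - ((1 - u) * v + u * w)
      = (1 - u) * (y + c * (s - x) - v) + u * (y + c * (t - x) - w)" for y c s t x v w :: real
    by (simp add: algebra_simps)
  then show ?thesis
    by (simp only: edge_gap_def fst_add snd_add fst_scaleR snd_scaleR real_scaleR_def)
qed

lemma edge_gap_eq_0_on_edge:
  assumes "a i \<noteq> 0" "i \<ge> 1"
    and "p \<in> closed_segment (psum a (i - 1), psum b (i - 1)) (psum a i, psum b i)"
  shows "edge_gap a b i p = 0"
proof -
  have "edge_gap a b i (psum a (i - 1), psum b (i - 1)) = 0"
    using assms psum_pred[of i a] psum_pred[of i b] by (simp add: edge_gap_def field_simps)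
  moreover have "edge_gap a b i (psum a i, psum b i) = 0"
    by (simp add: edge_gap_def)
  moreover obtain u where "p = (1 - u) *\<^sub>R (psum a (i - 1), psum b (i - 1)) + u *\<^sub>R (psum a i, psum b i)"
    using assms(3) unfolding in_segment by blast
  ultimately show ?thesis
    by (simp only: edge_gap_affine mult_zero_right add_0)
qed

section \<open>Strict separation of the two curves\<close>

locale decreasing_slopes =
  fixes d :: nat and \<sigma> :: "nat \<Rightarrow> nat" and a b :: "nat \<Rightarrow> real"
  assumes d: "d \<ge> 2"
    and pos: "\<forall>i\<in>{1..d}. a i > 0"
    and slope_Suc: "\<forall>i\<in>{1..<d}. b i / a i > b (Suc i) / a (Suc i)"
    and irr: "irreducible_perm d \<sigma>"
begin

lemma perm: "\<sigma> permutes {1..d}"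
  using irr by (simp add: irreducible_perm_def)

lemma inv_in: "k \<in> {1..d} \<Longrightarrow> inv \<sigma> k \<in> {1..d}"
  using permutes_in_image[OF permutes_inv[OF perm]] by blast

lemma pos_inv: "\<forall>i\<in>{1..d}. (a \<circ> inv \<sigma>) i > 0"
  using pos inv_in by simp

lemma slope_less:
  assumes "1 \<le> i" "i < j" "j \<le> d"
  shows "b j / a j < b i / a i"
  using assms(2,1,3)
proof (induction i j rule: less_Suc_induct)
  case (1 i)
  then show ?case using slope_Suc by simp
next
  case (2 i j k)
  then show ?case by fastforce
qed

text \<open>The gap is \<open>sum c {1..i} - sum c S\<close>, where \<open>c\<close> is positive
  before \<open>i\<close>, zero at \<open>i\<close> and negative after it, so \<open>{1..i}\<close>
  maximizes the sum over subsets. Equality makes \<open>S\<close> an initial segment, which is then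
  invariant under \<open>\<sigma>\<close>.\<close>

lemma edge_gap_vertex:
  assumes i: "i \<in> {1..d}" and k: "k \<le> d"
  shows "edge_gap a b i (psum (a \<circ> inv \<sigma>) k, psum (b \<circ> inv \<sigma>) k) \<ge> 0" (is "?g \<ge> 0")
    and "1 \<le> k \<Longrightarrow> k < d \<Longrightarrow> edge_gap a b i (psum (a \<circ> inv \<sigma>) k, psum (b \<circ> inv \<sigma>) k) > 0"
proof -
  define S where "S = inv \<sigma> ` {1..k}"
  \<comment> \<open>The rise of the \<open>j\<close>-th vector above a line of slope
    \<open>b i / a i\<close>.\<close>
  define c where "c j = b j - b i / a i * a j" for j
  have S: "S \<subseteq> {1..d}" "finite S"
    unfolding S_def using inv_in k by auto
  have c_pos: "c j > 0" if "j \<in> {1..<i}" for j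
  proof -
    have "a j > 0" using pos that i by simp
    then show ?thesis using slope_less[of j i] that i by (simp add: c_def field_simps)
  qed
  have c_neg: "c j < 0" if "j \<in> {i<..d}" for j
  proof -
    have "a j > 0" using pos that i by simp
    then show ?thesis using slope_less[of i j] that i by (simp add: c_def field_simps)
  qed
  have "a i > 0" using pos i by blast
  then have c_i: "c i = 0" by (simp add: c_def)
  have "?g = sum c {1..i} - sum c S"
    unfolding psum_permuted[OF perm] S_def[symmetric]
    by (simp add: edge_gap_def psum_def c_def sum_subtractf algebra_simps sum_distrib_left
        sum_divide_distrib)
  \<comment> \<open>The part common to \<open>{1..i}\<close> and \<open>S\<close> cancels, leaving
    two sums of nonnegative terms.\<close>
  also have "sum c {1..i} = sum c ({1..i} - S) + sum c ({1..i} \<inter> S)"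
    by (subst sum.union_disjoint[symmetric]) (auto intro: sum.cong)
  also have "sum c S = sum c (S - {1..i}) + sum c ({1..i} \<inter> S)"
    using S(2) by (subst sum.union_disjoint[symmetric]) (auto intro!: sum.cong)
  finally have g: "?g = sum c ({1..i} - S) + sum (\<lambda>j. - c j) (S - {1..i})"
    by (simp add: sum_negf del: comp_apply)
  have nn: "c j \<ge> 0" if "j \<in> {1..i} - S" for j
    using that c_pos[of j] c_i by (cases "j = i") auto
  have np: "- c j > 0" if "j \<in> S - {1..i}" for j
    using that c_neg[of j] S by auto
  have nns: "sum c ({1..i} - S) \<ge> 0" "sum (\<lambda>j. - c j) (S - {1..i}) \<ge> 0"
    by (rule sum_nonneg, rule nn, assumption) (rule sum_nonneg, rule less_imp_le, rule np)
  then show "?g \<ge> 0" using g by simp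
  assume k1: "1 \<le> k" "k < d"
  show "?g > 0"
  proof (rule ccontr)
    assume "\<not> ?g > 0"
    then have 0: "sum c ({1..i} - S) = 0" "sum (\<lambda>j. - c j) (S - {1..i}) = 0"
      using g nns by linarith+
    have "c j = 0" if "j \<in> {1..i} - S" for j
      using 0(1) nn that by (subst (asm) sum_nonneg_eq_0_iff) auto
    then have 1: "{1..<i} \<subseteq> S"
      using c_pos by fastforce
    have "- c j = 0" if "j \<in> S - {1..i}" for j
      using 0(2) np that S(2) by (subst (asm) sum_nonneg_eq_0_iff) (auto intro: less_imp_le)
    then have 2: "S \<subseteq> {1..i}"
      using np by fastforce
    have "inj (inv \<sigma>)"
      using permutes_inj[OF permutes_inv[OF perm]] .
    then have card: "card S = k"
      unfolding S_def by (subst card_image) (auto intro: inj_on_subset)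
    \<comment> \<open>Since \<open>c i = 0\<close>, equality leaves open only whether
      \<open>i\<close> belongs to \<open>S\<close>; in both cases the cardinality identifies the
      segment.\<close>
    have "S = {1..k}"
    proof (cases "i \<in> S")
      case True
      then have "S = {1..i}" using 1 2 by (auto simp: le_less)
      then show ?thesis using card by simp
    next
      case False
      have "{1..i} - {i} = {1..i - 1}" "{1..i - 1} = {1..<i}" using i by auto
      then have "S = {1..i - 1}" using 1 2 False by blast
      then show ?thesis using card by simp
    qed
    moreover have "\<sigma> ` S = {1..k}"
      unfolding S_def image_image by (simp add: permutes_inverses[OF perm])
    ultimately have "k = d"
      using irr k1 unfolding irreducible_perm_def by auto
    then show False using k1 by simp
  qed
qed

text \<open>The gap is a convex combination of two nonnegative vertex gaps, one of them positive. It
  could vanish only where all the weight falls on the other vertex, which is either inner as well or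
  an excluded end of the curve.\<close>

lemma edge_gap_bottom_pos:
  assumes i: "i \<in> {1..d}" and k: "k \<in> {1..d}"
    and p: "p \<in> closed_segment (psum (a \<circ> inv \<sigma>) (k - 1), psum (b \<circ> inv \<sigma>) (k - 1))
                               (psum (a \<circ> inv \<sigma>) k, psum (b \<circ> inv \<sigma>) k)"
    and ends: "p \<noteq> (0, 0)" "p \<noteq> (psum a d, psum b d)"
  shows "edge_gap a b i p > 0"
proof -
  define P where "P k = (psum (a \<circ> inv \<sigma>) k, psum (b \<circ> inv \<sigma>) k)" for k
  obtain u where u: "0 \<le> u" "u \<le> 1" and pu: "p = (1 - u) *\<^sub>R P (k - 1) + u *\<^sub>R P k"
    using p unfolding in_segment P_def by blast
  have gap: "edge_gap a b i p = (1 - u) * edge_gap a b i (P (k - 1)) + u * edge_gap a b i (P k)"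
    unfolding pu by (rule edge_gap_affine)
  have nn: "edge_gap a b i (P (k - 1)) \<ge> 0" "edge_gap a b i (P k) \<ge> 0"
    using edge_gap_vertex(1)[OF i] k by (auto simp: P_def)
  have P0: "P 0 = (0, 0)" and Pd: "P d = (psum a d, psum b d)"
    using psum_permuted_all[OF perm] by (auto simp: P_def)
  show ?thesis
  proof (cases "k = d")
    case True
    \<comment> \<open>On the last edge the vertex \<open>k - 1\<close> is inner because
      \<open>d \<ge> 2\<close>.\<close>
    have "edge_gap a b i (P (k - 1)) > 0"
      using edge_gap_vertex(2)[OF i, of "k - 1"] True d by (auto simp: P_def)
    moreover have "u \<noteq> 1"
      using ends(2) Pd True pu by auto
    ultimately show ?thesis
      using u nn unfolding gap by (intro add_pos_nonneg mult_pos_pos mult_nonneg_nonneg) auto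
  next
    case False
    have "edge_gap a b i (P k) > 0"
      using edge_gap_vertex(2)[OF i, of k] False k by (auto simp: P_def)
    show ?thesis
    proof (cases "u = 0")
      case True
      \<comment> \<open>Here \<open>p\<close> is the left vertex \<open>P (k - 1)\<close>; as it is
        not the origin, it is an inner vertex.\<close>
      then have "k \<noteq> 1" using ends(1) P0 pu by auto
      then have "edge_gap a b i (P (k - 1)) > 0"
        using edge_gap_vertex(2)[OF i, of "k - 1"] k by (auto simp: P_def)
      then show ?thesis using gap True by simp
    next
      case False
      then show ?thesis
        using \<open>edge_gap a b i (P k) > 0\<close> u nn unfolding gap
        by (intro add_nonneg_pos mult_pos_pos mult_nonneg_nonneg) auto
    qed
  qed
qed

text \<open>A common point has gap zero from the line of its top edge, but a bottom point other than
  the two ends has positive gap from every such line.\<close>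

lemma edges_meet_only_at_ends:
  assumes "i \<in> {1..d}" "k \<in> {1..d}"
    and "p \<in> closed_segment (psum a (i - 1), psum b (i - 1)) (psum a i, psum b i)"
    and "p \<in> closed_segment (psum (a \<circ> inv \<sigma>) (k - 1), psum (b \<circ> inv \<sigma>) (k - 1))
                            (psum (a \<circ> inv \<sigma>) k, psum (b \<circ> inv \<sigma>) k)"
  shows "p = (0, 0) \<or> p = (psum a d, psum b d)"
  using edge_gap_eq_0_on_edge[of a i p b] edge_gap_bottom_pos[of i k p] assms pos by fastforce

section \<open>Invariant measures\<close>

lemma iet_domain_permuted: "iet_domain d (a \<circ> inv \<sigma>) = iet_domain d a"
  by (simp add: iet_domain_def psum_permuted_all[OF perm])

text \<open>The translation matches right endpoints, and the two intervals have the same length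
  \<open>a j\<close>.\<close>

lemma iet_maps_interval:
  assumes "x \<in> iet_domain d a"
  shows "iet d \<sigma> a x \<in> iet_interval (a \<circ> inv \<sigma>) (\<sigma> (iet_index d a x))"
    and "\<sigma> (iet_index d a x) \<in> {1..d}"
proof -
  define j where "j = iet_index d a x"
  have j: "j \<in> {1..d}" "psum a (j - 1) \<le> x" "x < psum a j"
    using iet_index_in[OF pos assms] by (auto simp: j_def iet_interval_def)
  show s: "\<sigma> (iet_index d a x) \<in> {1..d}"
    using j(1) permutes_in_image[OF perm] unfolding j_def by blast
  have "psum (a \<circ> inv \<sigma>) (\<sigma> j) = psum (a \<circ> inv \<sigma>) (\<sigma> j - 1) + a j"
    using s psum_pred[of "\<sigma> j" "a \<circ> inv \<sigma>"] by (simp add: j_def permutes_inverses[OF perm])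
  moreover have "psum a j = psum a (j - 1) + a j"
    using j psum_pred[of j a] by simp
  ultimately show "iet d \<sigma> a x \<in> iet_interval (a \<circ> inv \<sigma>) (\<sigma> (iet_index d a x))"
    using j unfolding iet_def Let_def iet_interval_def j_def[symmetric] by simp
qed

lemma iet_in_domain:
  assumes "x \<in> iet_domain d a"
  shows "iet d \<sigma> a x \<in> iet_domain d a"
proof -
  define k where "k = \<sigma> (iet_index d a x)"
  have k: "k \<in> {1..d}" "iet d \<sigma> a x \<in> iet_interval (a \<circ> inv \<sigma>) k"
    using iet_maps_interval[OF assms] by (auto simp: k_def)
  have "0 \<le> psum (a \<circ> inv \<sigma>) (k - 1)" "psum (a \<circ> inv \<sigma>) k \<le> psum (a \<circ> inv \<sigma>) d"
    using k(1) psum_le[OF pos_inv, of 0 "k - 1"] psum_le[OF pos_inv, of k d]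
    by (auto simp del: comp_apply)
  with k(2) show ?thesis
    unfolding iet_domain_permuted[symmetric] by (auto simp: iet_domain_def iet_interval_def)
qed

lemma measurable_iet:
  "iet d \<sigma> a \<in> restrict_space borel (iet_domain d a) \<rightarrow>\<^sub>M restrict_space borel (iet_domain d a)"
proof -
  let ?R = "restrict_space borel (iet_domain d a)"
  have index_meas: "(\<lambda>x. h (iet_index d a x)) \<in> borel_measurable ?R" for h :: "nat \<Rightarrow> real"
    by (rule measurable_compose[OF measurable_iet_index[OF pos]]) simp
  have ident: "(\<lambda>x. x) \<in> borel_measurable ?R"
    by (intro measurable_restrict_space1) simp
  have "iet d \<sigma> a \<in> borel_measurable ?R"
    unfolding iet_def Let_def
    by (intro borel_measurable_add borel_measurable_diff ident index_meas
        index_meas[of "\<lambda>j. psum (a \<circ> inv \<sigma>) (\<sigma> j)"])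
  then show ?thesis
    using iet_in_domain by (intro measurable_restrict_space2) (auto simp: space_restrict_space)
qed

text \<open>The bottom edge over the image of the \<open>j\<close>-th interval has the slope
  \<open>b j / a j\<close> of the \<open>j\<close>-th top edge, and the offset from the right
  endpoint is preserved. The linear terms therefore cancel and only the vertex heights
  remain.\<close>

lemma height_fun_eq:
  assumes "x \<in> iet_domain d a"
  shows "height_fun d \<sigma> a b x =
    pl_interp d a b x - pl_interp d (a \<circ> inv \<sigma>) (b \<circ> inv \<sigma>) (iet d \<sigma> a x)"
proof -
  have "iet_index d (a \<circ> inv \<sigma>) (iet d \<sigma> a x) = \<sigma> (iet_index d a x)"
    using iet_maps_interval[OF assms] by (intro iet_index_eq[OF pos_inv])
  then show ?thesis
    by (simp add: height_fun_def pl_interp_def Let_def permutes_inverses[OF perm])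
       (simp add: iet_def Let_def)
qed

lemma bottom_less_top:
  assumes "x \<in> iet_domain d a" "x \<noteq> 0"
  shows "pl_interp d (a \<circ> inv \<sigma>) (b \<circ> inv \<sigma>) x < pl_interp d a b x"
proof -
  let ?p = "(x, pl_interp d (a \<circ> inv \<sigma>) (b \<circ> inv \<sigma>) x)"
  obtain k where k: "k \<in> {1..d}"
    "?p \<in> closed_segment (psum (a \<circ> inv \<sigma>) (k - 1), psum (b \<circ> inv \<sigma>) (k - 1))
                         (psum (a \<circ> inv \<sigma>) k, psum (b \<circ> inv \<sigma>) k)"
    using pl_interp_on_segment[OF pos_inv, of x] assms iet_domain_permuted by metis
  \<comment> \<open>For the top edge over \<open>x\<close> the gap is exactly the vertical distance
    of the curves. The right end is excluded because the domain is half-open.\<close>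
  have "edge_gap a b (iet_index d a x) ?p > 0"
    using assms by (intro edge_gap_bottom_pos[OF iet_index_in(1)[OF pos] k])
      (auto simp: iet_domain_def)
  then show ?thesis
    by (simp add: edge_gap_def pl_interp_def[of d a b] Let_def)
qed

lemma zero_in_domain: "0 \<in> iet_domain d a"
  using psum_less[OF pos, of 0 d] d by (simp add: iet_domain_def)

text \<open>Supplies the point left out of \<open>bottom_less_top\<close>, for nonnegativity on the
  whole domain.\<close>

lemma pl_interp_0:
  "pl_interp d a b 0 = 0" "pl_interp d (a \<circ> inv \<sigma>) (b \<circ> inv \<sigma>) 0 = 0"
proof -
  have *: "pl_interp d u v 0 = 0" if u: "\<forall>i\<in>{1..d}. u i > 0" for u v
  proof -
    have "u 1 > 0" using u d by simp
    then have "iet_index d u 0 = 1"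
      using d by (intro iet_index_eq[OF u]) (auto simp: iet_interval_def)
    then show ?thesis using \<open>u 1 > 0\<close> by (simp add: pl_interp_def Let_def)
  qed
  show "pl_interp d a b 0 = 0" "pl_interp d (a \<circ> inv \<sigma>) (b \<circ> inv \<sigma>) 0 = 0"
    using * pos pos_inv by auto
qed

text \<open>If \<open>0\<close> were fixed, the first top interval would also come first at the
  bottom, so \<open>{1}\<close> would be invariant and \<open>d = 1\<close>.\<close>

lemma iet_0_neq_0: "iet d \<sigma> a 0 \<noteq> 0"
proof
  assume eq: "iet d \<sigma> a 0 = 0"
  have "a 1 > 0" "(a \<circ> inv \<sigma>) 1 > 0" using pos pos_inv d by auto
  then have "iet_index d a 0 = 1" "iet_index d (a \<circ> inv \<sigma>) 0 = 1"
    using d by (auto intro!: iet_index_eq[OF pos] iet_index_eq[OF pos_inv] simp: iet_interval_def)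
  moreover have "iet_index d (a \<circ> inv \<sigma>) (iet d \<sigma> a 0) = \<sigma> (iet_index d a 0)"
    using iet_maps_interval[OF zero_in_domain] by (intro iet_index_eq[OF pos_inv])
  ultimately have "\<sigma> 1 = 1" using eq by simp
  then have "\<sigma> ` {1..1} \<subseteq> {1..1}" by simp
  moreover have "1 \<in> {1..d}" using d by simp
  ultimately have "1 = d"
    using irr unfolding irreducible_perm_def by blast
  then show False using d by simp
qed

lemma positive_pair: "positive_pair d \<sigma> a b"
  unfolding positive_pair_def
proof (intro allI impI)
  fix \<mu> assume inv: "iet_invariant_prob d \<sigma> a \<mu>"
  let ?R = "restrict_space borel (iet_domain d a)"
  let ?T = "iet d \<sigma> a"
  let ?F = "pl_interp d a b"
  let ?G = "pl_interp d (a \<circ> inv \<sigma>) (b \<circ> inv \<sigma>)"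
  have sp: "space \<mu> = iet_domain d a" and sets: "sets \<mu> = sets ?R"
    and prob: "prob_space \<mu>"
    and pres: "\<And>A. A \<in> sets \<mu> \<Longrightarrow> emeasure \<mu> (?T -` A \<inter> space \<mu>) = emeasure \<mu> A"
    using inv by (auto simp: iet_invariant_prob_def)
  interpret prob_space \<mu> by (rule prob)
  have F_meas: "?F \<in> borel_measurable \<mu>"
    using measurable_pl_interp[OF pos] unfolding measurable_cong_sets[OF sets refl] .
  have G_meas: "?G \<in> borel_measurable \<mu>"
    using measurable_pl_interp[OF pos_inv]
    unfolding iet_domain_permuted measurable_cong_sets[OF sets refl] .
  have T_meas: "?T \<in> \<mu> \<rightarrow>\<^sub>M \<mu>"
    using measurable_iet unfolding measurable_cong_sets[OF sets sets] .
  \<comment> \<open>Invariance as a pushforward identity, which lets \<open>?T\<close> be dropped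
    from the integral of \<open>?G (?T x)\<close>.\<close>
  have distr: "distr \<mu> \<mu> ?T = \<mu>"
    using T_meas by (intro measure_eqI) (auto simp: emeasure_distr pres)
  have F_int: "integrable \<mu> ?F"
    using pl_interp_bounded[OF pos, of _ b]
    by (intro integrable_const_bound[OF _ F_meas, of "2 * (\<Sum>i=1..d. \<bar>b i\<bar>)"] AE_I2) (auto simp: sp)
  have G_int: "integrable \<mu> ?G"
    using pl_interp_bounded[OF pos_inv, of _ "b \<circ> inv \<sigma>"] unfolding iet_domain_permuted
    by (intro integrable_const_bound[OF _ G_meas, of "2 * (\<Sum>i=1..d. \<bar>(b \<circ> inv \<sigma>) i\<bar>)"] AE_I2)
       (auto simp: sp simp del: comp_apply)
  have GT_int: "integrable \<mu> (\<lambda>x. ?G (?T x))"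
    using integrable_distr[OF T_meas, of ?G] G_int distr by simp
  have nn: "?F x - ?G x \<ge> 0" if "x \<in> space \<mu>" for x
    using bottom_less_top[of x] pl_interp_0 that by (cases "x = 0") (auto simp: sp)
  have "(\<integral>x. height_fun d \<sigma> a b x \<partial>\<mu>) = (\<integral>x. ?F x - ?G (?T x) \<partial>\<mu>)"
    by (intro Bochner_Integration.integral_cong) (auto simp: sp height_fun_eq)
  also have "\<dots> = (\<integral>x. ?F x \<partial>\<mu>) - (\<integral>x. ?G (?T x) \<partial>\<mu>)"
    using F_int GT_int by (rule Bochner_Integration.integral_diff)
  also have "(\<integral>x. ?G (?T x) \<partial>\<mu>) = (\<integral>x. ?G x \<partial>\<mu>)"
    using integral_distr[OF T_meas G_meas] distr by simp
  also have "(\<integral>x. ?F x \<partial>\<mu>) - (\<integral>x. ?G x \<partial>\<mu>) = (\<integral>x. ?F x - ?G x \<partial>\<mu>)"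
    using F_int G_int by simp
  finally have eq: "(\<integral>x. height_fun d \<sigma> a b x \<partial>\<mu>) = (\<integral>x. ?F x - ?G x \<partial>\<mu>)" .
  have "(\<integral>x. ?F x - ?G x \<partial>\<mu>) \<noteq> 0"
  proof
    assume "(\<integral>x. ?F x - ?G x \<partial>\<mu>) = 0"
    then have "AE x in \<mu>. ?F x - ?G x = 0"
      using F_int G_int nn by (subst (asm) integral_nonneg_eq_0_iff_AE) auto
    moreover have "AE x in \<mu>. x \<in> space \<mu>"
      by (rule AE_space)
    ultimately have AE0: "AE x in \<mu>. x = 0"
      by eventually_elim (use bottom_less_top sp in fastforce)
    \<comment> \<open>By invariance, concentration at \<open>0\<close> transfers to the images:
      almost every \<open>x\<close> satisfies both \<open>x = 0\<close> and \<open>?T x = 0\<close>,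
      against \<open>iet_0_neq_0\<close>.\<close>
    have "AE x in distr \<mu> \<mu> ?T. x = 0"
      unfolding distr by (rule AE0)
    then have "AE x in \<mu>. ?T x = 0"
      by (rule AE_distrD[OF T_meas])
    with AE0 have "AE x in \<mu>. False"
      by eventually_elim (use iet_0_neq_0 in auto)
    then show False by simp
  qed
  moreover have "(\<integral>x. ?F x - ?G x \<partial>\<mu>) \<ge> 0"
    using nn by (intro integral_nonneg_AE AE_I2)
  ultimately show "(\<integral>x. height_fun d \<sigma> a b x \<partial>\<mu>) > 0"
    using eq by simp
qed

end

theorem lemma0p3:
  fixes d :: nat and \<sigma> :: "nat \<Rightarrow> nat"
    and a b \<kappa> :: "nat \<Rightarrow> real" and \<zeta> :: "nat \<Rightarrow> real \<times> real"
  assumes "d \<ge> 2"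
    and "\<forall>i\<in>{1..d}. a i > 0"
    and "\<forall>i\<in>{1..d}. \<zeta> i = (a i, b i)"
    and "\<forall>i\<in>{1..d}. \<kappa> i = b i / a i"
    and "\<forall>i\<in>{1..<d}. \<kappa> i > \<kappa> (i + 1)"
    and "irreducible_perm d \<sigma>"
  shows "simple_path (top_curve d \<zeta> +++ reversepath (bottom_curve d \<sigma> \<zeta>)) \<and>
         path_image (top_curve d \<zeta>) \<inter> path_image (bottom_curve d \<sigma> \<zeta>) = {(0, 0), \<Sum>i=1..d. \<zeta> i} \<and>
         ((\<nexists>c. is_connection d \<sigma> a c) \<longrightarrow> positive_pair d \<sigma> a b)"
proof -
  interpret decreasing_slopes d \<sigma> a b
    using assms by unfold_locales auto
  have d1: "d \<ge> 1" using d by simp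
  have \<zeta>_inv: "\<forall>i\<in>{1..d}. (\<zeta> \<circ> inv \<sigma>) i = ((a \<circ> inv \<sigma>) i, (b \<circ> inv \<sigma>) i)"
    using assms(3) inv_in by simp
  note top = polygonal_curve[OF d1 pos assms(3), folded top_curve_def]
  \<comment> \<open>Unfolding the permuted totals gives the bottom arc literally the same final
    point as the top one.\<close>
  note bot = polygonal_curve[OF d1 pos_inv \<zeta>_inv, folded bottom_curve_def,
      unfolded psum_permuted_all[OF perm]]
  have sum: "(\<Sum>i=1..d. \<zeta> i) = (psum a d, psum b d)"
    using psum_pair[OF assms(3), of d] by (simp add: psum_def)
  have "path_image (top_curve d \<zeta>) \<inter> path_image (bottom_curve d \<sigma> \<zeta>)
      \<subseteq> {(0, 0), (psum a d, psum b d)}"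
    unfolding top(4) bot(4) using edges_meet_only_at_ends by blast
  moreover have "{(0, 0), (psum a d, psum b d)}
      \<subseteq> path_image (top_curve d \<zeta>) \<inter> path_image (bottom_curve d \<sigma> \<zeta>)"
    using top(2,3) bot(2,3) by (metis Int_iff empty_subsetI insert_subset pathfinish_in_path_image
        pathstart_in_path_image)
  ultimately have meet: "path_image (top_curve d \<zeta>) \<inter> path_image (bottom_curve d \<sigma> \<zeta>)
      = {(0, 0), (psum a d, psum b d)}"
    by blast
  \<comment> \<open>Two arcs that share exactly their endpoints form a simple loop once one of them
    is reversed.\<close>
  then have "simple_path (top_curve d \<zeta> +++ reversepath (bottom_curve d \<sigma> \<zeta>))"
    using top bot by (intro simple_path_join_loop) (auto simp: arc_reversepath)
  then show ?thesis
    using meet sum positive_pair by simp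
qed

end
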